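(* Let $A\in\mathbb{R}^{m\times n}$ have no zero row and no zero column, and let $B\in\mathbb{R}^{m\times p}$. Let $X^{(0)}\in\mathbb{R}^{n\times p}$ satisfy $X^{(0)}_{:,j}\in R(A^T)$ for $j=1,\dots,p$, let $Z^{(0)}=B$, and for $k\ge0$ let $$Z^{(k+1)}=Z^{(k)}-\frac{A_{:,j}}{\|A_{:,j}\|_2^2}\bigl((A_{:,j})^TZ^{(k)}\bigr),\qquad X^{(k+1)}=X^{(k)}+\frac{(A_{i,:})^T\bigl(B_{i,:}-Z^{(k+1)}_{i,:}-A_{i,:}X^{(k)}\bigr)}{\|A_{i,:}\|_2^2},$$ where at each iteration the row index $i$ and the column index $j$ of $A$ are selected at random with probabilities $\|A_{i,:}\|_2^2/\|A\|_F^2$ and $\|A_{:,j}\|_2^2/\|A\|_F^2$, respectively. Then $\{X^{(k)}\}$ converges linearly in mean square to $A^+B$, and for all $k\ge0$ $$E\bigl[\|X^{(k)}-A^+B\|_F^2\bigr]\le\frac{k\rho^k}{\|A\|_F^2}\|Z^{(0)}-Z^*\|_F^2+\rho^k\|X^{(0)}-A^+B\|_F^2,$$ where $\rho=1-\dfrac{\sigma_{\min}^2(A)}{\|A\|_F^2}$ and $Z^*=(I_m-AA^+)B$.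
   Context: $A_{i,:}$ and $A_{:,j}$ denote the $i$th row and $j$th column of $A$, $R(A^T)$ the column space of $A^T$, $A^+$ the Moore-Penrose inverse, $\|\cdot\|_F$ the Frobenius norm, $\sigma_{\min}(A)$ the smallest nonzero singular value of $A$, and $I_m$ the $m\times m$ identity. $A$ may be rank deficient and $AX=B$ may be inconsistent. All index selections (row and column, and over different iterations) are independent. "Converges linearly in mean square to $X^*$" means that $E[\|X^{(k)}-X^*\|_F^2]\to 0$ at a geometric rate (bounded by $c\,q^k$ for some $c\ge 0$ and $q\in[0,1)$). *)

theory Defs
  imports "HOL-Analysis.Analysis" "HOL-Probability.Probability"
begin

text \<open>
  An \<open>m \<times> n\<close> real matrix has type \<open>real^'n^'m\<close>. The norm that the library puts on this type is the
  Frobenius norm, and the norm on \<open>real^'n\<close> is the Euclidean norm.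
\<close>

lemma norm_matrix_eq_frobenius:
  fixes A :: "real^'n^'m"
  shows "norm A = sqrt (\<Sum>i\<in>UNIV. \<Sum>j\<in>UNIV. (A $ i $ j)\<^sup>2)"
  by (simp add: norm_vec_def L2_set_def sum_nonneg)

definition outer_product :: "real^'m \<Rightarrow> real^'n \<Rightarrow> real^'n^'m" where
  "outer_product u v = (\<chi> i j. u $ i * v $ j)"

definition is_moore_penrose :: "real^'n^'m \<Rightarrow> real^'m^'n \<Rightarrow> bool" where
  "is_moore_penrose A P \<longleftrightarrow>
     A ** P ** A = A \<and>
     P ** A ** P = P \<and>
     transpose (A ** P) = A ** P \<and>
     transpose (P ** A) = P ** A"

definition moore_penrose :: "real^'n^'m \<Rightarrow> real^'m^'n" where
  "moore_penrose A = (THE P. is_moore_penrose A P)"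

definition singular_value :: "real^'n^'m \<Rightarrow> real \<Rightarrow> bool" where
  "singular_value A \<sigma> \<longleftrightarrow>
     \<sigma> \<ge> 0 \<and> (\<exists>v. v \<noteq> 0 \<and> (transpose A ** A) *v v = \<sigma>\<^sup>2 *\<^sub>R v)"

text \<open>The set below is finite, and it is nonempty exactly when \<open>A \<noteq> 0\<close>.\<close>

definition sigma_min :: "real^'n^'m \<Rightarrow> real" where
  "sigma_min A = Min {\<sigma>. singular_value A \<sigma> \<and> \<sigma> \<noteq> 0}"

text \<open>
  One column step and one row step of the iteration. The product of a row vector \<open>v\<close> with a
  matrix \<open>M\<close> is \<open>v v* M\<close>, and a column times a row is an outer product.
\<close>

definition Z_step :: "real^'n^'m \<Rightarrow> 'n \<Rightarrow> real^'p^'m \<Rightarrow> real^'p^'m" where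
  "Z_step A j Z =
     Z - outer_product ((1 / (norm (column j A))\<^sup>2) *\<^sub>R column j A) (column j A v* Z)"

text \<open>The argument \<open>Z\<close> of the row step is the already updated matrix.\<close>

definition X_step ::
  "real^'n^'m \<Rightarrow> real^'p^'m \<Rightarrow> 'm \<Rightarrow> real^'p^'m \<Rightarrow> real^'p^'n \<Rightarrow> real^'p^'n" where
  "X_step A B i Z X =
     X + (1 / (norm (row i A))\<^sup>2) *\<^sub>R
           outer_product (row i A) (row i B - row i Z - row i A v* X)"

text \<open>
  Integrability is part of the notion because the library's integral of a non-integrable function is 0.
\<close>

definition converges_linearly_in_mean_square ::
  "'a measure \<Rightarrow> (nat \<Rightarrow> 'a \<Rightarrow> real^'p^'n) \<Rightarrow> real^'p^'n \<Rightarrow> bool" where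
  "converges_linearly_in_mean_square M X L \<longleftrightarrow>
     (\<forall>k. integrable M (\<lambda>\<omega>. (norm (X k \<omega> - L))\<^sup>2)) \<and>
     (\<exists>c q. 0 \<le> c \<and> 0 \<le> q \<and> q < 1 \<and>
        (\<forall>k. (LINT \<omega>|M. (norm (X k \<omega> - L))\<^sup>2) \<le> c * q ^ k))"

text \<open>
  All row indices \<open>I 0, I 1, \<dots>\<close> and column indices \<open>J 0, J 1, \<dots>\<close> together form one mutually independent
  family. Rows and columns are put into the sum type because \<open>indep_vars\<close> needs a common codomain.
  The distribution of each index is proportional to the squared norm of the selected row or column.
\<close>

definition random_selections ::
  "real^'n^'m \<Rightarrow> 'a measure \<Rightarrow> (nat \<Rightarrow> 'a \<Rightarrow> 'm) \<Rightarrow> (nat \<Rightarrow> 'a \<Rightarrow> 'n) \<Rightarrow> bool" where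
  "random_selections A M I J \<longleftrightarrow>
     prob_space.indep_vars M (\<lambda>_. count_space UNIV)
       (\<lambda>s \<omega>. case s of Inl k \<Rightarrow> Inl (I k \<omega>) | Inr k \<Rightarrow> Inr (J k \<omega>)) UNIV \<and>
     (\<forall>k i. measure M {\<omega> \<in> space M. I k \<omega> = i} = (norm (row i A))\<^sup>2 / (norm A)\<^sup>2) \<and>
     (\<forall>k j. measure M {\<omega> \<in> space M. J k \<omega> = j} = (norm (column j A))\<^sup>2 / (norm A)\<^sup>2)"

end

theory Submission
  imports Defs
begin

text \<open>
  Write \<open>F k = Z k - Z\<^sup>*\<close> and \<open>E k = X k - A\<^sup>+B\<close>. A column step projects \<open>F k\<close> orthogonally to the selected
  column; averaging gives a mean loss of \<open>\<parallel>A\<^sup>T F k\<parallel>\<^sup>2 / \<parallel>A\<parallel>\<^sup>2\<close>. A row step projects \<open>E k\<close> orthogonally to the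
  selected row and adds an orthogonal perturbation, so by Pythagoras the mean change is
  \<open>- \<parallel>A E k\<parallel>\<^sup>2 / \<parallel>A\<parallel>\<^sup>2 + \<parallel>F (k+1)\<parallel>\<^sup>2 / \<parallel>A\<parallel>\<^sup>2\<close>. The columns of \<open>F k\<close> stay in the range of \<open>A\<close> and those of
  \<open>E k\<close> in the range of \<open>A\<^sup>T\<close>, where \<open>A\<^sup>T\<close> and \<open>A\<close> expand norms by at least \<open>\<sigma>\<^sub>m\<^sub>i\<^sub>n\<close>; hence the two mean errors
  satisfy \<open>z (k+1) \<le> \<rho> z k\<close> and \<open>x (k+1) \<le> \<rho> x k + z (k+1) / \<parallel>A\<parallel>\<^sup>2\<close>.
\<close>

text \<open>As a simp rule it would turn \<open>transpose A *v x\<close> into \<open>x v* A\<close>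
  and hide the adjoint in terms of which the facts below are phrased.\<close>

declare transpose_matrix_vector [simp del]

section \<open>Rank-one updates and the Frobenius norm\<close>

lemma outer_product_inner:
  "outer_product u v \<bullet> M = v \<bullet> (u v* M)"
  unfolding outer_product_def inner_vec_def vector_matrix_mult_def
  apply (simp add: sum_distrib_left)
  apply (subst sum.swap)
  apply (simp add: algebra_simps)
  done

lemma vector_matrix_mult_outer_product:
  "w v* outer_product u v = (w \<bullet> u) *\<^sub>R v"
  by (simp add: outer_product_def vec_eq_iff vector_matrix_mult_def inner_vec_def
      sum_distrib_right mult.assoc)

lemma matrix_mult_outer_product:
  "A ** outer_product u v = outer_product (A *v u) v"
  by (simp add: outer_product_def vec_eq_iff matrix_matrix_mult_def matrix_vector_mult_def
      sum_distrib_right mult.assoc)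

lemma outer_product_scaleR:
  "outer_product (c *\<^sub>R u) v = c *\<^sub>R outer_product u v"
  by (simp add: outer_product_def vec_eq_iff)

lemma norm_matrix_rows: "(norm (A :: real^'n^'m))\<^sup>2 = (\<Sum>i\<in>UNIV. (norm (row i A))\<^sup>2)"
  by (simp add: norm_vec_def L2_set_def row_def sum_nonneg)

lemma norm_transpose: "norm (transpose A) = norm (A :: real^'n^'m)"
  unfolding norm_matrix_eq_frobenius transpose_def
  by simp (rule sum.swap)

lemma norm_matrix_columns: "(norm (A :: real^'n^'m))\<^sup>2 = (\<Sum>j\<in>UNIV. (norm (column j A))\<^sup>2)"
  using norm_matrix_rows[of "transpose A"] by (simp add: norm_transpose row_transpose)

lemma row_matrix_mult: "row i (A ** E) = row i A v* E"
  by (simp add: vec_eq_iff row_def matrix_matrix_mult_def vector_matrix_mult_def mult.commute)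

lemma column_matrix_mult: "column j (A ** E) = A *v column j E"
  by (simp add: vec_eq_iff column_def matrix_matrix_mult_def matrix_vector_mult_def)

text \<open>The new matrix is the projection of \<open>E\<close>, with columns orthogonal to
  \<open>u\<close>, minus a rank-one term with columns parallel to \<open>u\<close>, so Pythagoras
  applies. Column steps use \<open>f = 0\<close>; in row steps \<open>f\<close> is a row of the
  error of \<open>Z\<close>.\<close>

lemma norm_diff_outer_product:
  assumes "u \<noteq> 0"
  shows "(norm (E - (1 / (norm u)\<^sup>2) *\<^sub>R outer_product u (u v* E + f)))\<^sup>2
    = (norm E)\<^sup>2 - (norm (u v* E))\<^sup>2 / (norm u)\<^sup>2 + (norm f)\<^sup>2 / (norm u)\<^sup>2"
proof -
  define c g w where "c = 1 / (u \<bullet> u)" and "g = u v* E" and "w = g + f"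
  have c: "c * (u \<bullet> u) = 1" using assms by (simp add: c_def)
  have oE: "E \<bullet> outer_product u w = w \<bullet> g"
    unfolding g_def by (subst inner_commute) (rule outer_product_inner)
  have oo: "outer_product u w \<bullet> outer_product u w = (u \<bullet> u) * (w \<bullet> w)"
    by (simp add: outer_product_inner vector_matrix_mult_outer_product)
  have "(norm (E - c *\<^sub>R outer_product u w))\<^sup>2
    = (norm E)\<^sup>2 - 2 * c * (w \<bullet> g) + c * (c * (u \<bullet> u)) * (w \<bullet> w)"
    by (simp add: power2_norm_eq_inner inner_diff_left inner_diff_right oE oo
        inner_commute[of "outer_product u w" E]) (simp add: algebra_simps)
  \<comment> \<open>The factor \<open>c * (c * (u \<bullet> u))\<close> collapses to
    \<open>c\<close>, and with \<open>w = g + f\<close> the mixed terms in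
    \<open>f \<bullet> g\<close> cancel.\<close>
  also have "\<dots> = (norm E)\<^sup>2 - c * (g \<bullet> g) + c * (f \<bullet> f)"
    unfolding c w_def
    by (simp add: inner_add_left inner_add_right inner_commute[of f g] distrib_left)
  finally show ?thesis
    by (simp add: power2_norm_eq_inner c_def g_def w_def)
qed

text \<open>Cauchy-Schwarz in each row. The bound later gives
  \<open>sigma_min A \<le> norm A\<close>, hence nonnegativity of \<rho>.\<close>

lemma norm_matrix_vector_mult_le: "norm (A *v x) \<le> norm A * norm (x :: real^'n)" for A :: "real^'n^'m"
proof -
  have "(norm (A *v x))\<^sup>2 = (\<Sum>i\<in>UNIV. (row i A \<bullet> x)\<^sup>2)"
    by (simp add: norm_vec_def L2_set_def sum_nonneg matrix_vector_mul_component row_def)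
  also have "\<dots> \<le> (\<Sum>i\<in>UNIV. (norm (row i A))\<^sup>2 * (norm x)\<^sup>2)"
    by (intro sum_mono) (metis Cauchy_Schwarz_ineq power2_norm_eq_inner)
  also have "\<dots> = (norm A * norm x)\<^sup>2"
    by (simp add: norm_matrix_rows[of A] sum_distrib_right power_mult_distrib)
  finally show ?thesis by (rule power2_le_imp_le) simp
qed

section \<open>The Moore-Penrose inverse: uniqueness and existence\<close>

text \<open>Both \<open>A ** P\<close> and \<open>A ** Q\<close> are symmetric and each absorbs the
  other on one side; transposing shows that they agree. The same holds for \<open>P ** A\<close> and
  \<open>Q ** A\<close>, and \<open>P ** A ** P\<close> then becomes
  \<open>Q ** A ** Q\<close>.\<close>

lemma is_moore_penrose_unique:
  assumes "is_moore_penrose A P" "is_moore_penrose A Q"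
  shows "P = Q"
proof -
  note P = assms(1)[unfolded is_moore_penrose_def] and Q = assms(2)[unfolded is_moore_penrose_def]
  have "A ** P = (A ** Q) ** (A ** P)"
    using Q by (simp add: matrix_mul_assoc)
  also have "\<dots> = transpose ((A ** P) ** (A ** Q))"
    using P Q by (simp add: matrix_transpose_mul)
  also have "\<dots> = A ** Q"
    using P Q by (simp add: matrix_mul_assoc)
  finally have AP: "A ** P = A ** Q" .
  have "P ** A = (P ** A) ** (Q ** A)"
    using Q by (metis matrix_mul_assoc)
  also have "\<dots> = transpose ((Q ** A) ** (P ** A))"
    using P Q by (simp add: matrix_transpose_mul)
  also have "\<dots> = Q ** A"
    using P Q by (metis matrix_mul_assoc)
  finally have PA: "P ** A = Q ** A" .
  have "P = P ** A ** P" using P by simp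
  also have "\<dots> = Q ** A ** Q" using PA AP by (metis matrix_mul_assoc)
  finally show ?thesis using Q by simp
qed

lemma inner_matrix_vector_mult:
  "(A *v x) \<bullet> y = x \<bullet> (transpose A *v y)" for A :: "real^'n^'m"
  by (metis dot_lmul_matrix inner_commute transpose_matrix_vector)

lemma matrix_vector_mult_eq_0_iff_gram:
  "transpose A *v (A *v x) = 0 \<longleftrightarrow> A *v x = 0" for A :: "real^'n^'m"
proof
  assume "transpose A *v (A *v x) = 0"
  then have "(A *v x) \<bullet> (A *v x) = 0"
    by (metis inner_matrix_vector_mult inner_zero_right)
  then show "A *v x = 0" by simp
qed simp

lemma kernel_inter_range_transpose:
  fixes A :: "real^'n^'m"
  assumes "A *v x = 0" "x \<in> range ((*v) (transpose A))"
  shows "x = 0" 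
  using assms matrix_vector_mult_eq_0_iff_gram[of "transpose A"] by auto

text \<open>The Moore-Penrose inverse is constructed as the map sending \<open>y\<close> to its least-squares solution of minimal norm.\<close>

lemma least_squares_exists:
  fixes A :: "real^'n^'m"
  shows "\<exists>x\<in>range ((*v) (transpose A)). transpose A *v (y - A *v x) = 0"
proof -
  \<comment> \<open>Projecting \<open>z\<close> orthogonally onto the range of \<open>C\<close>
    leaves a residual orthogonal to that range, which is the normal equation.\<close>
  have decomp: "\<exists>x. transpose C *v (z - C *v x) = 0" for C :: "real^'k^'l" and z
  proof -
    have "subspace (range ((*v) C))"
      by (intro linear_subspace_image matrix_vector_mul_linear subspace_UNIV)
    then obtain u v where u: "u \<in> range ((*v) C)" and v: "\<And>w. w \<in> range ((*v) C) \<Longrightarrow> orthogonal v w"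
      and z: "z = u + v"
      using orthogonal_subspace_decomp_exists[of "range ((*v) C)" z] by (metis span_eq_iff)
    from u obtain x where x: "u = C *v x" by auto
    have "w \<bullet> (transpose C *v v) = 0" for w
      using v[of "C *v w"] unfolding inner_matrix_vector_mult[symmetric]
      by (simp add: orthogonal_def inner_commute)
    then have "transpose C *v v = 0" by (metis inner_eq_zero_iff)
    then have "transpose C *v (z - C *v x) = 0" using x z by simp
    then show ?thesis ..
  qed
  obtain x0 where x0: "transpose A *v (y - A *v x0) = 0" using decomp by blast
  \<comment> \<open>The same fact for \<open>transpose A\<close> removes from \<open>x0\<close> its
    component in the kernel of \<open>A\<close>. This moves the solution into the row space and
    leaves \<open>A *v x0\<close> unchanged.\<close>
  obtain w where w: "A *v (x0 - transpose A *v w) = 0" using decomp[of "transpose A" x0] by auto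
  show ?thesis
  proof
    show "transpose A *v (y - A *v (transpose A *v w)) = 0"
      using x0 w by (simp add: matrix_vector_mult_diff_distrib)
  qed simp
qed

text \<open>The difference of two solutions lies both in the kernel of \<open>A\<close> and in the
  range of \<open>transpose A\<close>, which meet only in zero.\<close>

lemma least_squares_unique:
  fixes A :: "real^'n^'m"
  assumes "x \<in> range ((*v) (transpose A))" "transpose A *v (y - A *v x) = 0"
    and "x' \<in> range ((*v) (transpose A))" "transpose A *v (y - A *v x') = 0"
  shows "x = x'"
proof -
  have "transpose A *v (A *v (x - x')) = 0"
    using assms(2,4) by (simp add: matrix_vector_mult_diff_distrib)
  then have "A *v (x - x') = 0" by (simp add: matrix_vector_mult_eq_0_iff_gram)
  moreover have "x - x' \<in> range ((*v) (transpose A))"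
    using assms(1,3) by (auto simp: matrix_vector_mult_diff_distrib[symmetric])
  ultimately show ?thesis using kernel_inter_range_transpose by (metis eq_iff_diff_eq_0)
qed

lemma symmetric_matrixI:
  fixes C :: "real^'n^'n"
  assumes "\<And>x y. (C *v x) \<bullet> y = x \<bullet> (C *v y)"
  shows "transpose C = C"
proof -
  have "x \<bullet> (transpose C *v y) = x \<bullet> (C *v y)" for x y
    using assms inner_matrix_vector_mult by metis
  then have "transpose C *v y = C *v y" for y by (metis vector_eq_rdot inner_commute)
  then show ?thesis by (simp add: matrix_eq)
qed

text \<open>Uniqueness of the solution makes the chosen map \<open>f\<close> linear. Its matrix is
  the inverse sought, because composing \<open>f\<close> with \<open>A\<close> in either order gives
  an orthogonal projection.\<close>

lemma is_moore_penrose_exists: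
  fixes A :: "real^'n^'m"
  shows "\<exists>P. is_moore_penrose A P"
proof -
  let ?S = "range ((*v) (transpose A))"
  obtain f where f: "\<And>y. f y \<in> ?S" and fA: "\<And>y. transpose A *v (y - A *v f y) = 0"
    using least_squares_exists[of A] by metis
  have uniq: "x = f y" if "x \<in> ?S" "transpose A *v (y - A *v x) = 0" for x y
    using least_squares_unique that f fA by blast
  have sub: "subspace ?S"
    by (intro linear_subspace_image matrix_vector_mul_linear subspace_UNIV)
  have "linear f"
  proof (rule linearI)
    fix x y show "f (x + y) = f x + f y"
    proof (rule uniq[symmetric])
      show "f x + f y \<in> ?S" using sub f by (simp add: subspace_add)
      show "transpose A *v (x + y - A *v (f x + f y)) = 0"
        using fA[of x] fA[of y] by (simp add: algebra_simps)
    qed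
  next
    fix c :: real and x show "f (c *\<^sub>R x) = c *\<^sub>R f x"
    proof (rule uniq[symmetric])
      show "c *\<^sub>R f x \<in> ?S" using sub f by (simp add: subspace_scale)
      have "c *\<^sub>R x - A *v (c *\<^sub>R f x) = c *\<^sub>R (x - A *v f x)"
        by (simp add: algebra_simps)
      then show "transpose A *v (c *\<^sub>R x - A *v (c *\<^sub>R f x)) = 0"
        using fA[of x] by (simp add: matrix_vector_mult_scaleR)
    qed
  qed
  then have P: "matrix f *v y = f y" for y using matrix_vector_mul(2) by metis
  have AfA: "A *v f (A *v x) = A *v x" for x
  proof -
    have "transpose A *v (A *v (x - f (A *v x))) = 0"
      using fA[of "A *v x"] by (simp add: algebra_simps)
    then have "A *v (x - f (A *v x)) = 0" by (simp only: matrix_vector_mult_eq_0_iff_gram)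
    then show ?thesis by (simp add: matrix_vector_mult_diff_distrib)
  qed
  have fAf: "f (A *v f y) = f y" for y
    by (rule uniq[symmetric]) (simp_all add: f)
  \<comment> \<open>\<open>A *v f y\<close> is the orthogonal projection of \<open>y\<close> onto
    the range of \<open>A\<close>; this gives symmetry of \<open>A ** matrix f\<close>. The next
    fact does the same for \<open>matrix f ** A\<close> and the row space.\<close>
  have normal: "(A *v x) \<bullet> (A *v f y) = (A *v x) \<bullet> y" for x y
  proof -
    have "(A *v x) \<bullet> (y - A *v f y) = 0" by (simp add: inner_matrix_vector_mult fA)
    then show ?thesis by (simp add: inner_diff_right)
  qed
  have normal': "x \<bullet> f (A *v y) = x \<bullet> y" if "x \<in> ?S" for x y
    using that AfA by (auto simp: inner_matrix_vector_mult)
  have "is_moore_penrose A (matrix f)"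
    unfolding is_moore_penrose_def
  proof (intro conjI)
    show "A ** matrix f ** A = A"
      by (simp add: matrix_eq P AfA flip: matrix_vector_mul_assoc)
    show "matrix f ** A ** matrix f = matrix f"
      by (simp add: matrix_eq P fAf flip: matrix_vector_mul_assoc)
    show "transpose (A ** matrix f) = A ** matrix f"
      by (rule symmetric_matrixI) (metis P matrix_vector_mul_assoc normal inner_commute)
    show "transpose (matrix f ** A) = matrix f ** A"
      by (rule symmetric_matrixI) (metis P matrix_vector_mul_assoc normal' f inner_commute)
  qed
  then show ?thesis by blast
qed

lemma is_moore_penrose_moore_penrose: "is_moore_penrose A (moore_penrose A)"
  unfolding moore_penrose_def
  by (rule theI') (metis is_moore_penrose_exists is_moore_penrose_unique)

section \<open>Singular values and the smallest gain on the row space\<close>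

lemma norm_plus_scaleR:
  "(norm (x + t *\<^sub>R y))\<^sup>2 = (norm x)\<^sup>2 + 2 * t * (x \<bullet> y) + t\<^sup>2 * (norm y)\<^sup>2"
  by (simp add: power2_norm_eq_inner inner_add_left inner_add_right inner_commute[of y x])
    (simp add: power2_eq_square distrib_left)

text \<open>Eigenvectors of the symmetric Gram matrix for distinct eigenvalues are orthogonal, hence
  independent, so there are only finitely many. Nonnegativity of singular values makes distinct ones
  have distinct squares.\<close>

lemma finite_singular_values:
  fixes A :: "real^'n^'m"
  shows "finite {\<sigma>. singular_value A \<sigma>}"
proof -
  let ?G = "transpose A ** A" and ?\<Sigma> = "{\<sigma>. singular_value A \<sigma>}"
  have "\<forall>\<sigma>\<in>?\<Sigma>. \<exists>v. v \<noteq> 0 \<and> ?G *v v = \<sigma>\<^sup>2 *\<^sub>R v"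
    by (simp add: singular_value_def)
  then obtain v where v: "\<And>\<sigma>. \<sigma> \<in> ?\<Sigma> \<Longrightarrow> v \<sigma> \<noteq> 0 \<and> ?G *v v \<sigma> = \<sigma>\<^sup>2 *\<^sub>R v \<sigma>"
    by (metis (no_types, lifting) bchoice)
  have orth: "orthogonal (v \<sigma>) (v \<tau>)" if "\<sigma> \<in> ?\<Sigma>" "\<tau> \<in> ?\<Sigma>" "\<sigma> \<noteq> \<tau>" for \<sigma> \<tau>
  proof -
    have "(?G *v v \<sigma>) \<bullet> v \<tau> = v \<sigma> \<bullet> (?G *v v \<tau>)"
      by (simp add: inner_matrix_vector_mult matrix_transpose_mul)
    then have "(\<sigma>\<^sup>2 - \<tau>\<^sup>2) * (v \<sigma> \<bullet> v \<tau>) = 0"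
      using v[OF that(1)] v[OF that(2)] by (simp add: algebra_simps)
    moreover have "\<sigma>\<^sup>2 \<noteq> \<tau>\<^sup>2"
      using that by (simp add: singular_value_def power2_eq_iff_nonneg)
    ultimately show ?thesis by (simp add: orthogonal_def)
  qed
  have inj: "inj_on v ?\<Sigma>"
    using orth v by (metis (no_types, lifting) inj_onI orthogonal_self)
  have "pairwise orthogonal (v ` ?\<Sigma>)"
    using orth by (auto simp: pairwise_def)
  moreover have "0 \<notin> v ` ?\<Sigma>" using v by force
  ultimately have "finite (v ` ?\<Sigma>)"
    by (intro finiteI_independent pairwise_orthogonal_independent)
  then show ?thesis using inj by (rule finite_imageD)
qed

text \<open>
  The minimum of \<open>\<parallel>A x\<parallel>\<close> over the unit sphere of the row space is a singular value, because at a
  minimizer \<open>v\<close> the first variation in the direction \<open>A\<^sup>T A v - \<sigma>\<^sup>2 v\<close> must vanish.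
\<close>

lemma singular_value_min_gain:
  fixes A :: "real^'n^'m"
  assumes "A \<noteq> 0"
  shows "\<exists>\<sigma>>0. singular_value A \<sigma> \<and> (\<forall>x\<in>range ((*v) (transpose A)). \<sigma> * norm x \<le> norm (A *v x))"
proof -
  let ?S = "range ((*v) (transpose A))"
  have sub: "subspace ?S"
    by (intro linear_subspace_image matrix_vector_mul_linear subspace_UNIV)
  obtain w where "transpose A *v w \<noteq> 0"
    using assms kernel_inter_range_transpose[of "transpose A"]
    by (metis matrix_eq matrix_vector_mult_0 rangeI transpose_transpose)
  then have "(1 / norm (transpose A *v w)) *\<^sub>R (transpose A *v w) \<in> ?S \<inter> sphere 0 1"
    using subspace_scale[OF sub rangeI] by simp
  moreover have "compact (?S \<inter> sphere 0 1)"
    using closed_subspace[OF sub] by (simp add: closed_Int_compact)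
  moreover have "continuous_on (?S \<inter> sphere 0 1) (\<lambda>x. norm (A *v x))"
    by (intro continuous_intros)
  ultimately have "\<exists>v\<in>?S \<inter> sphere 0 1. \<forall>x\<in>?S \<inter> sphere 0 1. norm (A *v v) \<le> norm (A *v x)"
    by (intro continuous_attains_inf) blast+
  then obtain v where v: "v \<in> ?S" "norm v = 1"
    and vmin: "\<And>x. x \<in> ?S \<Longrightarrow> norm x = 1 \<Longrightarrow> norm (A *v v) \<le> norm (A *v x)"
    by (metis IntD1 IntD2 IntI mem_sphere_0)
  define \<sigma> where "\<sigma> = norm (A *v v)"
  have gain: "\<sigma> * norm x \<le> norm (A *v x)" if "x \<in> ?S" for x
  proof (cases "x = 0")
    case False
    have "(1 / norm x) *\<^sub>R x \<in> ?S" using sub that by (rule subspace_scale)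
    then have "\<sigma> \<le> norm (A *v ((1 / norm x) *\<^sub>R x))"
      unfolding \<sigma>_def using False by (intro vmin) simp_all
    then show ?thesis using False by (simp add: matrix_vector_mult_scaleR field_simps)
  qed simp
  have "A *v v \<noteq> 0" using v kernel_inter_range_transpose[of A v] by auto
  then have pos: "\<sigma> > 0" by (simp add: \<sigma>_def)
  \<comment> \<open>Half the gradient at \<open>v\<close> of the function \<open>x \<mapsto> (norm
    (A *v x))\<^sup>2 - \<sigma>\<^sup>2 * (norm x)\<^sup>2\<close>, which is nonnegative on the row
    space and vanishes at \<open>v\<close>. \<open>K\<close> is its value at
    \<open>g\<close>.\<close>
  define g where "g = transpose A *v (A *v v) - \<sigma>\<^sup>2 *\<^sub>R v"
  define K where "K = (norm (A *v g))\<^sup>2 - \<sigma>\<^sup>2 * (norm g)\<^sup>2"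
  have gS: "g \<in> ?S" unfolding g_def using sub v by (intro subspace_diff subspace_scale) auto
  have gg: "(A *v v) \<bullet> (A *v g) - \<sigma>\<^sup>2 * (v \<bullet> g) = (norm g)\<^sup>2"
  proof -
    have "(A *v v) \<bullet> (A *v g) = g \<bullet> (transpose A *v (A *v v))"
      by (metis inner_matrix_vector_mult inner_commute)
    then show ?thesis
      by (simp add: g_def power2_norm_eq_inner inner_diff_left inner_diff_right inner_commute algebra_simps)
  qed
  have K: "K \<ge> 0"
    using power_mono[OF gain[OF gS], of 2] pos by (simp add: K_def power_mult_distrib)
  have quad: "0 \<le> 2 * t * (norm g)\<^sup>2 + t\<^sup>2 * K" for t
  proof -
    have "v + t *\<^sub>R g \<in> ?S" using sub v gS by (intro subspace_add subspace_scale)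
    then have "\<sigma>\<^sup>2 * (norm (v + t *\<^sub>R g))\<^sup>2 \<le> (norm (A *v (v + t *\<^sub>R g)))\<^sup>2"
      using power_mono[OF gain, of "v + t *\<^sub>R g" 2] pos by (simp add: power_mult_distrib)
    also have "\<dots> = \<sigma>\<^sup>2 + 2 * t * ((A *v v) \<bullet> (A *v g)) + t\<^sup>2 * (norm (A *v g))\<^sup>2"
      by (simp add: \<sigma>_def matrix_vector_right_distrib matrix_vector_mult_scaleR norm_plus_scaleR)
    also have "(norm (v + t *\<^sub>R g))\<^sup>2 = 1 + 2 * t * (v \<bullet> g) + t\<^sup>2 * (norm g)\<^sup>2"
      using v(2) by (simp add: norm_plus_scaleR)
    finally show ?thesis unfolding gg[symmetric] K_def by (simp add: algebra_simps)
  qed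
  have "(norm g)\<^sup>2 = 0"
  proof -
    \<comment> \<open>Taking \<open>t = - b\<close> in \<open>quad\<close> leaves
      \<open>- b\<^sup>2 * (K + 2)\<close> on the right, which forces \<open>b = 0\<close>. The
      summand 1 keeps the denominator positive.\<close>
    define b where "b = (norm g)\<^sup>2 / (K + 1)"
    have b: "(norm g)\<^sup>2 = b * (K + 1)" using K by (simp add: b_def)
    have "b\<^sup>2 * (K + 2) \<le> 0"
      using quad[of "- b"] unfolding b by (simp add: power2_eq_square algebra_simps)
    then show ?thesis unfolding b using K by (simp add: mult_le_0_iff)
  qed
  then have "transpose A *v (A *v v) = \<sigma>\<^sup>2 *\<^sub>R v" by (simp add: g_def)
  then have "singular_value A \<sigma>"
    using pos v(2) by (auto simp: singular_value_def matrix_vector_mul_assoc intro!: exI[of _ v])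
  with pos gain show ?thesis by blast
qed

text \<open>The gain bound holds for some positive singular value and so for the smallest one. An
  eigenvector belonging to \<open>sigma_min A\<close> is stretched by exactly that factor, which the
  Frobenius norm bounds.\<close>

lemma sigma_min_facts:
  fixes A :: "real^'n^'m"
  assumes "A \<noteq> 0"
  shows sigma_min_pos: "sigma_min A > 0"
    and sigma_min_le_norm: "sigma_min A \<le> norm A"
    and sigma_min_gain:
      "x \<in> range ((*v) (transpose A)) \<Longrightarrow> sigma_min A * norm x \<le> norm (A *v x)"
proof -
  let ?\<Sigma> = "{\<sigma>. singular_value A \<sigma> \<and> \<sigma> \<noteq> 0}"
  have fin: "finite ?\<Sigma>" using finite_singular_values[of A] by (rule rev_finite_subset) auto
  obtain \<sigma> where \<sigma>: "\<sigma> > 0" "singular_value A \<sigma>"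
    and gain: "\<And>x. x \<in> range ((*v) (transpose A)) \<Longrightarrow> \<sigma> * norm x \<le> norm (A *v x)"
    using singular_value_min_gain[OF assms] by blast
  have le: "sigma_min A \<le> \<sigma>" unfolding sigma_min_def using fin \<sigma> by (intro Min_le) auto
  have "sigma_min A \<in> ?\<Sigma>" unfolding sigma_min_def using fin \<sigma> by (intro Min_in) auto
  then have sv: "singular_value A (sigma_min A)" and nz: "sigma_min A \<noteq> 0" by auto
  then show pos: "sigma_min A > 0" by (simp add: singular_value_def)
  from sv obtain v where v: "v \<noteq> 0" "(transpose A ** A) *v v = (sigma_min A)\<^sup>2 *\<^sub>R v"
    by (auto simp: singular_value_def)
  have "(norm (A *v v))\<^sup>2 = v \<bullet> ((transpose A ** A) *v v)"
    by (simp add: power2_norm_eq_inner inner_matrix_vector_mult matrix_vector_mul_assoc)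
  also have "\<dots> = (sigma_min A * norm v)\<^sup>2"
    by (simp add: v power_mult_distrib power2_norm_eq_inner)
  finally have "norm (A *v v) = sigma_min A * norm v" using pos by simp
  then show "sigma_min A \<le> norm A"
    using norm_matrix_vector_mult_le[of A v] v(1) by simp
  show "sigma_min A * norm x \<le> norm (A *v x)" if "x \<in> range ((*v) (transpose A))"
    using gain[OF that] mult_right_mono[OF le, of "norm x"] by simp
qed

text \<open>
  \<open>A\<close> and \<open>A\<^sup>T\<close> have the same nonzero singular values; writing \<open>y = A x\<close> with \<open>x\<close> in the row space,
  \<open>\<parallel>y\<parallel>\<^sup>2 = x \<bullet> A\<^sup>T y\<close> transfers the bound directly.
\<close>

lemma sigma_min_gain_transpose:
  fixes A :: "real^'n^'m"
  assumes "A \<noteq> 0" and x: "x \<in> range ((*v) (transpose A))" and y: "y = A *v x"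
  shows "sigma_min A * norm y \<le> norm (transpose A *v y)"
proof (cases "y = 0")
  case False
  let ?s = "sigma_min A"
  have s: "?s > 0" using assms(1) by (rule sigma_min_pos)
  have "(norm y)\<^sup>2 = x \<bullet> (transpose A *v y)"
    by (simp add: y power2_norm_eq_inner inner_matrix_vector_mult)
  also have "\<dots> \<le> norm x * norm (transpose A *v y)" by (rule norm_cauchy_schwarz)
  finally have "?s * (norm y)\<^sup>2 \<le> (?s * norm x) * norm (transpose A *v y)"
    using s by simp
  also have "\<dots> \<le> norm y * norm (transpose A *v y)"
    using sigma_min_gain[OF assms(1) x] by (simp add: y mult_right_mono)
  finally have "norm y * (?s * norm y) \<le> norm y * norm (transpose A *v y)"
    by (simp add: power2_eq_square mult_ac)
  then show ?thesis using False by (simp only: mult_le_cancel_left) simp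
qed simp


section \<open>Moore-Penrose projections and the gain for whole matrices\<close>

lemma matrix_mult_diff_left: "A ** (B - C) = A ** B - A ** C" for A :: "'a::comm_ring_1^'n^'m"
  by (simp add: vec_eq_iff matrix_matrix_mult_def right_diff_distrib sum_subtractf)

lemma matrix_mult_diff_right: "(A - B) ** C = A ** C - B ** C" for A :: "'a::comm_ring_1^'n^'m"
  by (simp add: vec_eq_iff matrix_matrix_mult_def left_diff_distrib sum_subtractf)

lemma
  fixes A :: "real^'n^'m"
  shows mult_moore_penrose_mult: "A ** moore_penrose A ** A = A"
    and moore_penrose_mult_transpose: "moore_penrose A ** A ** transpose A = transpose A"
    and transpose_mult_moore_penrose: "transpose A ** A ** moore_penrose A = transpose A"
    and moore_penrose_mult_idem:
      "moore_penrose A ** A ** moore_penrose A = moore_penrose A"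
    and transpose_moore_penrose_mult:
      "transpose (moore_penrose A ** A) = moore_penrose A ** A"
proof -
  let ?P = "moore_penrose A"
  note P = is_moore_penrose_moore_penrose[of A, unfolded is_moore_penrose_def]
  show APA: "A ** ?P ** A = A" and "?P ** A ** ?P = ?P" and PA: "transpose (?P ** A) = ?P ** A"
    using P by auto
  have "transpose (A ** (?P ** A)) = ?P ** A ** transpose A"
    by (subst matrix_transpose_mul) (simp only: PA)
  then show "?P ** A ** transpose A = transpose A" by (simp add: matrix_mul_assoc APA)
  have "transpose A ** (A ** ?P) = transpose A ** transpose (A ** ?P)" using P by simp
  also have "\<dots> = transpose (A ** ?P ** A)" by (simp only: matrix_transpose_mul)
  finally show "transpose A ** A ** ?P = transpose A" by (simp add: APA matrix_mul_assoc)
qed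

text \<open>With P the inverse, P = P A P, and by symmetry of P A the factor P A equals A^T
  P^T.\<close>

lemma moore_penrose_in_range_transpose:
  "moore_penrose A *v y \<in> range ((*v) (transpose A))" for A :: "real^'n^'m"
proof -
  have "moore_penrose A *v y = transpose (moore_penrose A ** A) *v (moore_penrose A *v y)"
    by (simp add: transpose_moore_penrose_mult moore_penrose_mult_idem matrix_vector_mul_assoc)
  also have "\<dots> = transpose A *v (transpose (moore_penrose A) *v (moore_penrose A *v y))"
    by (simp add: matrix_transpose_mul matrix_vector_mul_assoc matrix_mul_assoc)
  finally show ?thesis by (metis rangeI)
qed

text \<open>The second assumption encodes that every column of \<open>E\<close> lies in the range of
  \<open>transpose A\<close>. Squared Frobenius norms are sums over columns, so the vector bound
  adds up.\<close>

lemma sigma_min_gain_matrix: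
  fixes A :: "real^'n^'m" and E :: "real^'p^'n"
  assumes "A \<noteq> 0" "moore_penrose A ** A ** E = E"
  shows "(sigma_min A)\<^sup>2 * (norm E)\<^sup>2 \<le> (norm (A ** E))\<^sup>2"
proof -
  have "(sigma_min A * norm (column j E))\<^sup>2 \<le> (norm (A *v column j E))\<^sup>2" for j
  proof (rule power_mono)
    have "column j E = moore_penrose A *v (A *v column j E)"
      by (metis assms(2) column_matrix_mult matrix_vector_mul_assoc)
    then have "column j E \<in> range ((*v) (transpose A))"
      by (metis moore_penrose_in_range_transpose)
    then show "sigma_min A * norm (column j E) \<le> norm (A *v column j E)"
      by (rule sigma_min_gain[OF assms(1)])
  qed (simp add: sigma_min_pos[OF assms(1)] less_imp_le)
  then show ?thesis
    by (simp add: norm_matrix_columns[of E] norm_matrix_columns[of "A ** E"] column_matrix_mult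
        sum_distrib_left power_mult_distrib sum_mono)
qed

lemma sigma_min_gain_transpose_matrix:
  fixes A :: "real^'n^'m" and F :: "real^'p^'m"
  assumes "A \<noteq> 0" "A ** moore_penrose A ** F = F"
  shows "(sigma_min A)\<^sup>2 * (norm F)\<^sup>2 \<le> (norm (transpose A ** F))\<^sup>2"
proof -
  have "(sigma_min A * norm (column j F))\<^sup>2 \<le> (norm (transpose A *v column j F))\<^sup>2" for j
  proof (rule power_mono)
    have "column j F = A *v (moore_penrose A *v column j F)"
      by (metis assms(2) column_matrix_mult matrix_vector_mul_assoc)
    then show "sigma_min A * norm (column j F) \<le> norm (transpose A *v column j F)"
      by (rule sigma_min_gain_transpose[OF assms(1) moore_penrose_in_range_transpose])
  qed (simp add: sigma_min_pos[OF assms(1)] less_imp_le)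
  then show ?thesis
    by (simp add: norm_matrix_columns[of F] norm_matrix_columns[of "transpose A ** F"]
        column_matrix_mult sum_distrib_left power_mult_distrib sum_mono)
qed

section \<open>Single steps: error recursion, invariant subspaces, mean contraction\<close>

text \<open>\<open>Zs\<close> is the component of \<open>B\<close> orthogonal to the range of
  \<open>A\<close>, so every column of \<open>A\<close> annihilates it and the step acts on the
  error alone. The summand \<open>0\<close> fits the shape of
  \<open>norm_diff_outer_product\<close>.\<close>

lemma Z_step_error:
  fixes A :: "real^'n^'m" and B Z :: "real^'p^'m"
  defines "Zs \<equiv> (mat 1 - A ** moore_penrose A) ** B"
  shows "Z_step A j Z - Zs = (Z - Zs) -
    (1 / (norm (column j A))\<^sup>2) *\<^sub>R outer_product (column j A) (column j A v* (Z - Zs) + 0)"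
proof -
  have "transpose A ** Zs = 0"
    by (simp add: Zs_def matrix_mul_assoc matrix_mult_diff_left transpose_mult_moore_penrose)
  then have "row j (transpose A ** Zs) = 0" by (simp add: row_def vec_eq_iff)
  then have "column j A v* Zs = 0" by (simp add: row_matrix_mult)
  then show ?thesis
    by (simp add: Z_step_def outer_product_scaleR vector_matrix_mult_diff_rdistrib)
qed

text \<open>Since \<open>Zs = B - A ** Xs\<close>, the residual in the step is minus the selected
  row of A (X - Xs) plus that of Z - Zs, both taken with the minus sign.\<close>

lemma X_step_error:
  fixes A :: "real^'n^'m" and B Z :: "real^'p^'m"
  defines "Zs \<equiv> (mat 1 - A ** moore_penrose A) ** B" and "Xs \<equiv> moore_penrose A ** B"
  shows "X_step A B i Z X - Xs = (X - Xs) -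
    (1 / (norm (row i A))\<^sup>2) *\<^sub>R
      outer_product (row i A) (row i A v* (X - Xs) + row i (Z - Zs))"
proof -
  have row_diff: "row i (C - D) = row i C - row i D" for C D :: "real^'p^'m"
    by (simp add: row_def vec_eq_iff)
  have "Zs = B - A ** Xs"
    by (simp add: Zs_def Xs_def matrix_mult_diff_right matrix_mul_assoc)
  then have "row i B - row i Z - row i A v* X = - (row i A v* (X - Xs) + row i (Z - Zs))"
    by (simp add: row_diff row_matrix_mult vector_matrix_mult_diff_rdistrib)
  moreover have "outer_product (row i A) (- w) = - outer_product (row i A) w" for w :: "real^'p"
    by (simp add: outer_product_def vec_eq_iff)
  ultimately have "outer_product (row i A) (row i B - row i Z - row i A v* X)
    = - outer_product (row i A) (row i A v* (X - Xs) + row i (Z - Zs))" by (simp only:)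
  then show ?thesis by (simp add: X_step_def)
qed

text \<open>The update changes each column of the error by a multiple of a column of
  \<open>A\<close>, which the projection onto the range of \<open>A\<close> fixes.\<close>

lemma Z_step_invariant:
  fixes A :: "real^'n^'m" and B Z :: "real^'p^'m"
  defines "Zs \<equiv> (mat 1 - A ** moore_penrose A) ** B"
  assumes "A ** moore_penrose A ** (Z - Zs) = Z - Zs"
  shows "A ** moore_penrose A ** (Z_step A j Z - Zs) = Z_step A j Z - Zs"
proof -
  have "(A ** moore_penrose A) *v column j A = column j A"
    by (metis column_matrix_mult mult_moore_penrose_mult)
  then show ?thesis
    using assms(2) unfolding Zs_def
    by (simp add: Z_step_error matrix_mult_diff_left matrix_mult_outer_product
        flip: outer_product_scaleR)
      (simp add: matrix_mult_outer_product matrix_vector_mult_scaleR)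
qed

lemma moore_penrose_mult_row: "(moore_penrose A ** A) *v row i A = row i A" for A :: "real^'n^'m"
  by (metis column_matrix_mult moore_penrose_mult_transpose column_transpose)

lemma X_step_invariant:
  fixes A :: "real^'n^'m" and B Z :: "real^'p^'m"
  defines "Xs \<equiv> moore_penrose A ** B"
  assumes "moore_penrose A ** A ** (X - Xs) = X - Xs"
  shows "moore_penrose A ** A ** (X_step A B i Z X - Xs) = X_step A B i Z X - Xs"
  using assms(2) unfolding Xs_def
  by (simp add: X_step_error matrix_mult_diff_left matrix_mult_outer_product
      flip: outer_product_scaleR)
    (simp add: matrix_mult_outer_product matrix_vector_mult_scaleR moore_penrose_mult_row)

text \<open>The selection probabilities cancel the denominators of the projection losses, which then
  sum to the squared norm of \<open>transpose A ** (Z - Zs)\<close>; the gain bound on the range of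
  \<open>A\<close> finishes.\<close>

lemma Z_step_mean_contraction:
  fixes A :: "real^'n^'m" and B Z :: "real^'p^'m"
  defines "Zs \<equiv> (mat 1 - A ** moore_penrose A) ** B"
  assumes "\<And>j. column j A \<noteq> 0" and inv: "A ** moore_penrose A ** (Z - Zs) = Z - Zs"
  shows "(\<Sum>j\<in>UNIV. (norm (column j A))\<^sup>2 / (norm A)\<^sup>2 * (norm (Z_step A j Z - Zs))\<^sup>2)
    \<le> (1 - (sigma_min A)\<^sup>2 / (norm A)\<^sup>2) * (norm (Z - Zs))\<^sup>2"
proof -
  let ?F = "Z - Zs"
  \<comment> \<open>Index types are nonempty, so any one nonzero column will do.\<close>
  have A: "A \<noteq> 0" using assms(2)[of undefined] by (auto simp: column_def vec_eq_iff)
  have "(norm (column j A))\<^sup>2 * (norm (Z_step A j Z - Zs))\<^sup>2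
    = (norm (column j A))\<^sup>2 * (norm ?F)\<^sup>2 - (norm (row j (transpose A ** ?F)))\<^sup>2" for j
    unfolding Zs_def Z_step_error using assms(2)
    by (subst norm_diff_outer_product) (simp_all add: row_matrix_mult field_simps)
  then have "(\<Sum>j\<in>UNIV. (norm (column j A))\<^sup>2 * (norm (Z_step A j Z - Zs))\<^sup>2)
    = (norm A)\<^sup>2 * (norm ?F)\<^sup>2 - (norm (transpose A ** ?F))\<^sup>2"
    by (simp add: sum_subtractf norm_matrix_rows[of "transpose A ** ?F"] norm_matrix_columns[of A]
        sum_distrib_right)
  also have "\<dots> \<le> (norm A)\<^sup>2 * (norm ?F)\<^sup>2 - (sigma_min A)\<^sup>2 * (norm ?F)\<^sup>2"
    using sigma_min_gain_transpose_matrix[OF A inv] by simp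
  finally show ?thesis
    using A by (simp add: sum_divide_distrib[symmetric] field_simps)
qed

text \<open>As for the column step, but the weights also turn the perturbations by rows of
  \<open>Z - Zs\<close> into its full squared norm.\<close>

lemma X_step_mean_contraction:
  fixes A :: "real^'n^'m" and B Z :: "real^'p^'m"
  defines "Zs \<equiv> (mat 1 - A ** moore_penrose A) ** B" and "Xs \<equiv> moore_penrose A ** B"
  assumes "\<And>i. row i A \<noteq> 0" and inv: "moore_penrose A ** A ** (X - Xs) = X - Xs"
  shows "(\<Sum>i\<in>UNIV. (norm (row i A))\<^sup>2 / (norm A)\<^sup>2 * (norm (X_step A B i Z X - Xs))\<^sup>2)
    \<le> (1 - (sigma_min A)\<^sup>2 / (norm A)\<^sup>2) * (norm (X - Xs))\<^sup>2 + (norm (Z - Zs))\<^sup>2 / (norm A)\<^sup>2"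
proof -
  let ?E = "X - Xs" and ?F = "Z - Zs"
  have A: "A \<noteq> 0" using assms(3)[of undefined] by (auto simp: row_def vec_eq_iff)
  have "(norm (row i A))\<^sup>2 * (norm (X_step A B i Z X - Xs))\<^sup>2
    = (norm (row i A))\<^sup>2 * (norm ?E)\<^sup>2 - (norm (row i (A ** ?E)))\<^sup>2 + (norm (row i ?F))\<^sup>2" for i
    unfolding Zs_def Xs_def X_step_error using assms(3)
    by (subst norm_diff_outer_product) (simp_all add: row_matrix_mult field_simps)
  then have "(\<Sum>i\<in>UNIV. (norm (row i A))\<^sup>2 * (norm (X_step A B i Z X - Xs))\<^sup>2)
    = (norm A)\<^sup>2 * (norm ?E)\<^sup>2 - (norm (A ** ?E))\<^sup>2 + (norm ?F)\<^sup>2"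
    by (simp add: sum_subtractf sum.distrib norm_matrix_rows[of "A ** ?E"] norm_matrix_rows[of A]
        norm_matrix_rows[of ?F] sum_distrib_right)
  also have "\<dots> \<le> (norm A)\<^sup>2 * (norm ?E)\<^sup>2 - (sigma_min A)\<^sup>2 * (norm ?E)\<^sup>2 + (norm ?F)\<^sup>2"
    using sigma_min_gain_matrix[OF A inv] by simp
  finally show ?thesis
    using A by (simp add: sum_divide_distrib[symmetric] field_simps)
qed

text \<open>The fixed vectors of the projection form a subspace containing the rows of
  \<open>A\<close>. This brings the assumption on the starting matrix into the form of the
  invariant.\<close>

lemma moore_penrose_mult_eq_if_columns_in_span:
  fixes A :: "real^'n^'m" and X :: "real^'p^'n"
  assumes "\<And>j. column j X \<in> span (columns (transpose A))"
  shows "moore_penrose A ** A ** X = X"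
proof -
  let ?T = "{x. (moore_penrose A ** A) *v x = x}"
  have "subspace ?T"
    by (auto simp: subspace_def matrix_vector_right_distrib matrix_vector_mult_scaleR)
  moreover have "columns (transpose A) \<subseteq> ?T"
    by (auto simp: rows_def moore_penrose_mult_row)
  ultimately have "span (columns (transpose A)) \<subseteq> ?T" by (rule span_minimal[rotated])
  then have "column j (moore_penrose A ** A ** X) = column j X" for j
    using assms[of j] by (auto simp: column_matrix_mult)
  then show ?thesis by (simp add: column_def vec_eq_iff)
qed

section \<open>Functions of finitely many independent indices\<close>

text \<open>Dependence on coordinates replaces measurability with respect to a generated
  sigma-algebra: for finite \<open>K\<close> and finite index types, a real function of this form is
  automatically measurable and bounded.\<close>

definition determined_by :: "'a measure \<Rightarrow> ('s \<Rightarrow> 'a \<Rightarrow> 'c) \<Rightarrow> 's set \<Rightarrow> ('a \<Rightarrow> 'b) \<Rightarrow> bool" where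
  "determined_by M Y K U \<longleftrightarrow> (\<exists>g. \<forall>\<omega>\<in>space M. U \<omega> = g (restrict (\<lambda>s. Y s \<omega>) K))"

lemma determined_by_const:
  "(\<And>\<omega>. \<omega> \<in> space M \<Longrightarrow> U \<omega> = c) \<Longrightarrow> determined_by M Y K U"
  unfolding determined_by_def by (intro exI[of _ "\<lambda>_. c"]) simp

lemma determined_by_coordinate: "s \<in> K \<Longrightarrow> determined_by M Y K (\<lambda>\<omega>. h (Y s \<omega>))"
  unfolding determined_by_def by (intro exI[of _ "\<lambda>y. h (y s)"]) simp

lemma determined_by_compose:
  assumes "determined_by M Y K U"
  shows "determined_by M Y K (\<lambda>\<omega>. h (U \<omega>))"
proof -
  obtain g where "\<forall>\<omega>\<in>space M. U \<omega> = g (restrict (\<lambda>s. Y s \<omega>) K)"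
    using assms unfolding determined_by_def by blast
  then show ?thesis unfolding determined_by_def by (intro exI[of _ "\<lambda>y. h (g y)"]) simp
qed

lemma determined_by_mono:
  assumes "determined_by M Y K U" "K \<subseteq> L"
  shows "determined_by M Y L U"
proof -
  obtain g where g: "\<forall>\<omega>\<in>space M. U \<omega> = g (restrict (\<lambda>s. Y s \<omega>) K)"
    using assms(1) unfolding determined_by_def by blast
  have "restrict (restrict (\<lambda>s. Y s \<omega>) L) K = restrict (\<lambda>s. Y s \<omega>) K" for \<omega>
    using assms(2) by (auto simp: restrict_def fun_eq_iff)
  with g show ?thesis
    unfolding determined_by_def by (intro exI[of _ "\<lambda>y. g (restrict y K)"]) simp
qed

lemma determined_by_compose2:
  assumes "determined_by M Y K U" "determined_by M Y K V"
    and "\<And>\<omega>. \<omega> \<in> space M \<Longrightarrow> W \<omega> = h (U \<omega>) (V \<omega>)"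
  shows "determined_by M Y K W"
proof -
  obtain f g where "\<forall>\<omega>\<in>space M. U \<omega> = f (restrict (\<lambda>s. Y s \<omega>) K)"
    and "\<forall>\<omega>\<in>space M. V \<omega> = g (restrict (\<lambda>s. Y s \<omega>) K)"
    using assms(1,2) unfolding determined_by_def by blast
  with assms(3) show ?thesis
    unfolding determined_by_def by (intro exI[of _ "\<lambda>y. h (f y) (g y)"]) simp
qed

lemma measurable_PiM_count_space_finite:
  fixes g :: "('s \<Rightarrow> 'c::finite) \<Rightarrow> real"
  assumes "finite K"
  shows "g \<in> borel_measurable (PiM K (\<lambda>_. count_space UNIV))"
  using assms by (simp add: count_space_PiM_finite countable_finite)

context prob_space
begin

lemma integrable_determined_by:
  fixes Y :: "'s \<Rightarrow> 'a \<Rightarrow> 'c::finite" and U :: "'a \<Rightarrow> real"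
  assumes Y: "\<And>s. random_variable (count_space UNIV) (Y s)" and K: "finite K"
    and U: "determined_by M Y K U"
  shows "integrable M U"
proof -
  let ?R = "\<lambda>\<omega>. restrict (\<lambda>s. Y s \<omega>) K" and ?E = "PiE K (\<lambda>_. UNIV :: 'c set)"
  obtain g where g: "\<And>\<omega>. \<omega> \<in> space M \<Longrightarrow> U \<omega> = g (?R \<omega>)"
    using U unfolding determined_by_def by blast
  have fin: "finite ?E" using K by (simp add: finite_PiE)
  have "?R \<in> measurable M (PiM K (\<lambda>_. count_space UNIV))"
    using Y by (rule measurable_restrict)
  then have "(\<lambda>\<omega>. g (?R \<omega>)) \<in> borel_measurable M"
    using measurable_PiM_count_space_finite[OF K] by (rule measurable_compose)
  then have "integrable M (\<lambda>\<omega>. g (?R \<omega>))"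
  proof (rule integrable_const_bound[rotated])
    \<comment> \<open>Only finitely many tuples of index values occur; the sum over all of them
      bounds each single value.\<close>
    show "AE \<omega> in M. norm (g (?R \<omega>)) \<le> (\<Sum>y\<in>?E. norm (g y))"
      using fin by (intro AE_I2 member_le_sum) auto
  qed
  then show ?thesis using g by (simp cong: Bochner_Integration.integrable_cong)
qed

lemma expectation_mult_determined_by:
  fixes Y :: "'s \<Rightarrow> 'a \<Rightarrow> 'c::finite" and U V :: "'a \<Rightarrow> real"
  assumes Y: "indep_vars (\<lambda>_. count_space UNIV) Y UNIV"
    and KL: "finite K" "finite L" "K \<inter> L = {}"
    and U: "determined_by M Y K U" and V: "determined_by M Y L V"
  shows "expectation (\<lambda>\<omega>. U \<omega> * V \<omega>) = expectation U * expectation V"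
proof -
  let ?R = "\<lambda>K \<omega>. restrict (\<lambda>s. Y s \<omega>) K"
  have rv: "random_variable (count_space UNIV) (Y s)" for s
    using Y by (simp add: indep_vars_def)
  obtain f g where f: "\<And>\<omega>. \<omega> \<in> space M \<Longrightarrow> U \<omega> = f (?R K \<omega>)"
    and g: "\<And>\<omega>. \<omega> \<in> space M \<Longrightarrow> V \<omega> = g (?R L \<omega>)"
    using U V unfolding determined_by_def by blast
  have "indep_var borel (f \<circ> ?R K) borel (g \<circ> ?R L)"
    by (rule indep_var_compose[OF indep_var_restrict[OF Y KL(3) subset_UNIV subset_UNIV]])
      (simp_all add: measurable_PiM_count_space_finite KL)
  moreover have "integrable M (f \<circ> ?R K)"
    by (rule integrable_determined_by[OF rv KL(1)]) (auto simp: determined_by_def)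
  moreover have "integrable M (g \<circ> ?R L)"
    by (rule integrable_determined_by[OF rv KL(2)]) (auto simp: determined_by_def)
  ultimately have "expectation (\<lambda>\<omega>. f (?R K \<omega>) * g (?R L \<omega>))
    = expectation (\<lambda>\<omega>. f (?R K \<omega>)) * expectation (\<lambda>\<omega>. g (?R L \<omega>))"
    using indep_var_lebesgue_integral[of "f \<circ> ?R K" "g \<circ> ?R L"] by (simp add: comp_def)
  then show ?thesis using f g by (simp cong: Bochner_Integration.integral_cong)
qed

text \<open>This replaces conditioning on the past: split according to the value of
  \<open>V\<close>, then factor each term, since \<open>V\<close> depends on a coordinate outside
  \<open>K\<close>.\<close>

lemma expectation_independent_index:
  fixes Y :: "'s \<Rightarrow> 'a \<Rightarrow> 'c::finite" and f :: "'v::finite \<Rightarrow> 'a \<Rightarrow> real"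
  assumes Y: "indep_vars (\<lambda>_. count_space UNIV) Y UNIV"
    and K: "finite K" "s \<notin> K"
    and f: "\<And>v. determined_by M Y K (f v)" and V: "determined_by M Y {s} V"
  shows "expectation (\<lambda>\<omega>. f (V \<omega>) \<omega>)
    = expectation (\<lambda>\<omega>. \<Sum>v\<in>UNIV. prob {\<omega> \<in> space M. V \<omega> = v} * f v \<omega>)"
proof -
  have rv: "random_variable (count_space UNIV) (Y s)" for s
    using Y by (simp add: indep_vars_def)
  define D where "D v \<omega> = (of_bool (V \<omega> = v) :: real)" for v \<omega>
  have D: "determined_by M Y {s} (D v)" for v
    unfolding D_def by (rule determined_by_compose[OF V])
  have int: "integrable M (f v)" for v
    using rv K(1) f by (rule integrable_determined_by)
  have intD: "integrable M (\<lambda>\<omega>. f v \<omega> * D v \<omega>)" for v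
  proof (rule integrable_determined_by[OF rv])
    show "finite (insert s K)" using K(1) by simp
    have "determined_by M Y (insert s K) (f v)" "determined_by M Y (insert s K) (D v)"
      by (rule determined_by_mono[OF f subset_insertI], rule determined_by_mono[OF D]) simp
    then show "determined_by M Y (insert s K) (\<lambda>\<omega>. f v \<omega> * D v \<omega>)"
      by (rule determined_by_compose2) simp
  qed
  have eD: "expectation (D v) = prob {\<omega> \<in> space M. V \<omega> = v}" for v
  proof -
    have "{\<omega> \<in> space M. V \<omega> = v} = D v -` {1} \<inter> space M" by (auto simp: D_def)
    also have "\<dots> \<in> events"
      using integrable_determined_by[OF rv _ D] by (intro measurable_sets[of _ _ borel]) auto
    finally have "expectation (indicator {\<omega> \<in> space M. V \<omega> = v}) = prob {\<omega> \<in> space M. V \<omega> = v}"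
      by (simp add: Int_absorb2 sets.sets_into_space)
    then show ?thesis
      by (subst (asm) Bochner_Integration.integral_cong[of M M _ "D v"]) (auto simp: D_def indicator_def)
  qed
  have "expectation (\<lambda>\<omega>. f (V \<omega>) \<omega>) = expectation (\<lambda>\<omega>. \<Sum>v\<in>UNIV. f v \<omega> * D v \<omega>)"
    by (simp add: D_def)
  also have "\<dots> = (\<Sum>v\<in>UNIV. expectation (\<lambda>\<omega>. f v \<omega> * D v \<omega>))"
    using intD by (intro Bochner_Integration.integral_sum)
  also have "\<dots> = (\<Sum>v\<in>UNIV. prob {\<omega> \<in> space M. V \<omega> = v} * expectation (f v))"
  proof (rule sum.cong[OF refl])
    fix v
    have "expectation (\<lambda>\<omega>. f v \<omega> * D v \<omega>) = expectation (f v) * expectation (D v)"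
      using K by (intro expectation_mult_determined_by[OF Y K(1) _ _ f D]) simp_all
    then show "expectation (\<lambda>\<omega>. f v \<omega> * D v \<omega>)
      = prob {\<omega> \<in> space M. V \<omega> = v} * expectation (f v)"
      by (simp add: eD)
  qed
  also have "\<dots> = expectation (\<lambda>\<omega>. \<Sum>v\<in>UNIV. prob {\<omega> \<in> space M. V \<omega> = v} * f v \<omega>)"
    using int by (simp add: Bochner_Integration.integral_sum)
  finally show ?thesis .
qed

end

text \<open>The factor \<open>k\<close> is absorbed by any rate strictly between \<open>\<rho>\<close> and \<open>1\<close>; the midpoint is used.\<close>

lemma linear_times_power_bounded:
  fixes \<rho> a b :: real
  assumes "0 \<le> \<rho>" "\<rho> < 1" "0 \<le> a" "0 \<le> b"
  shows "\<exists>c q. 0 \<le> c \<and> 0 \<le> q \<and> q < 1 \<and> (\<forall>k. real k * \<rho> ^ k * a + \<rho> ^ k * b \<le> c * q ^ k)"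
proof -
  define q where "q = (1 + \<rho>) / 2"
  \<comment> \<open>Division by \<open>q ^ k\<close> turns \<open>\<rho> ^ k\<close> into
    \<open>r ^ k\<close>, and \<open>real k * r ^ k\<close> is bounded because it tends to
    zero.\<close>
  define r where "r = \<rho> / q"
  have q: "0 < q" "q < 1" "\<rho> < q" using assms(1,2) by (auto simp: q_def)
  have r: "0 \<le> r" "r < 1" using assms(1) q by (simp_all add: r_def)
  have rq: "\<rho> = r * q" using q(1) by (simp add: r_def)
  have "(\<lambda>k. real k * r ^ k) \<longlonglongrightarrow> 0" using r by (intro powser_times_n_limit_0) simp
  then have "Bseq (\<lambda>k. real k * r ^ k)" by (intro convergent_imp_Bseq convergentI)
  then obtain C where C: "C > 0" "\<And>k. norm (real k * r ^ k) \<le> C" by (auto elim: BseqE)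
  have "real k * \<rho> ^ k * a + \<rho> ^ k * b \<le> (C * a + b) * q ^ k" for k
  proof -
    have "real k * r ^ k * a + r ^ k * b \<le> C * a + 1 * b"
      using C(2)[of k] r assms by (intro add_mono mult_right_mono power_le_one) auto
    then have "(real k * r ^ k * a + r ^ k * b) * q ^ k \<le> (C * a + b) * q ^ k"
      using q by (intro mult_right_mono) auto
    then show ?thesis by (simp add: rq power_mult_distrib algebra_simps)
  qed
  moreover have "0 \<le> C * a + b" using C(1) assms by simp
  ultimately show ?thesis using q by (intro exI[of _ "C * a + b"] exI[of _ q]) auto
qed

section \<open>The random iteration: mean error recursions and their solution\<close>

theorem theorem4p3:
  fixes A :: "real^'n^'m" and B :: "real^'p^'m"
    and X0 :: "real^'p^'n"
    and M :: "'a measure"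
    and I :: "nat \<Rightarrow> 'a \<Rightarrow> 'm" and J :: "nat \<Rightarrow> 'a \<Rightarrow> 'n"
    and Z :: "nat \<Rightarrow> 'a \<Rightarrow> real^'p^'m" and X :: "nat \<Rightarrow> 'a \<Rightarrow> real^'p^'n"
    and \<rho> :: real and Zstar :: "real^'p^'m"
  assumes "\<And>i. row i A \<noteq> 0" and "\<And>j. column j A \<noteq> 0"
    and "\<And>j. column j X0 \<in> span (columns (transpose A))"
    and "prob_space M"
    and "random_selections A M I J"
    and "\<And>\<omega>. \<omega> \<in> space M \<Longrightarrow> Z 0 \<omega> = B"
    and "\<And>\<omega>. \<omega> \<in> space M \<Longrightarrow> X 0 \<omega> = X0"
    and "\<And>k \<omega>. \<omega> \<in> space M \<Longrightarrow> Z (Suc k) \<omega> = Z_step A (J k \<omega>) (Z k \<omega>)"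
    and "\<And>k \<omega>. \<omega> \<in> space M \<Longrightarrow> X (Suc k) \<omega> = X_step A B (I k \<omega>) (Z (Suc k) \<omega>) (X k \<omega>)"
    and "\<rho> = 1 - (sigma_min A)\<^sup>2 / (norm A)\<^sup>2"
    and "Zstar = (mat 1 - A ** moore_penrose A) ** B"
  shows "converges_linearly_in_mean_square M X (moore_penrose A ** B) \<and>
    (\<forall>k. (LINT \<omega>|M. (norm (X k \<omega> - moore_penrose A ** B))\<^sup>2)
          \<le> real k * \<rho> ^ k / (norm A)\<^sup>2 * (norm (B - Zstar))\<^sup>2
            + \<rho> ^ k * (norm (X0 - moore_penrose A ** B))\<^sup>2)"
proof -
  interpret prob_space M by fact
  define Y where "Y s \<omega> = (case s of Inl k \<Rightarrow> Inl (I k \<omega>) | Inr k \<Rightarrow> Inr (J k \<omega>))"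
    for s :: "nat + nat" and \<omega>
  have indep: "indep_vars (\<lambda>_. count_space UNIV) Y UNIV"
    and probI: "\<And>k i. prob {\<omega> \<in> space M. I k \<omega> = i} = (norm (row i A))\<^sup>2 / (norm A)\<^sup>2"
    and probJ: "\<And>k j. prob {\<omega> \<in> space M. J k \<omega> = j} = (norm (column j A))\<^sup>2 / (norm A)\<^sup>2"
    using assms(5) by (auto simp: random_selections_def Y_def[abs_def])
  have rv: "random_variable (count_space UNIV) (Y s)" for s
    using indep by (simp add: indep_vars_def)
  have detI: "determined_by M Y K (I k)" if "Inl k \<in> K" for k K
    using determined_by_coordinate[OF that, where h = projl and Y = Y and M = M] by (simp add: Y_def)
  have detJ: "determined_by M Y K (J k)" if "Inr k \<in> K" for k K
    using determined_by_coordinate[OF that, where h = projr and Y = Y and M = M] by (simp add: Y_def)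
  define past :: "nat \<Rightarrow> (nat + nat) set" where "past k = Inl ` {..<k} \<union> Inr ` {..<k}" for k
  have fin: "finite (past k)" for k by (simp add: past_def)
  \<comment> \<open>The \<open>Z\<close> iterates depend on column indices only; \<open>X k\<close>
    also needs the earlier row indices.\<close>
  have detZ: "determined_by M Y (Inr ` {..<k}) (Z k)" for k
  proof (induction k)
    case 0
    show ?case using assms(6) by (rule determined_by_const)
  next
    case (Suc k)
    have *: "determined_by M Y (Inr ` {..<Suc k}) (Z k)"
      using Suc by (rule determined_by_mono) auto
    show ?case
      by (rule determined_by_compose2[OF detJ *, where h = "Z_step A"]) (simp_all add: assms(8))
  qed
  have detX: "determined_by M Y (past k) (X k)" for k
  proof (induction k)
    case 0
    show ?case using assms(7) by (rule determined_by_const)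
  next
    case (Suc k)
    have "determined_by M Y (past (Suc k)) (X k)"
      using Suc by (rule determined_by_mono) (auto simp: past_def)
    moreover have "determined_by M Y (past (Suc k)) (Z (Suc k))"
      using detZ by (rule determined_by_mono) (auto simp: past_def)
    ultimately have *: "determined_by M Y (past (Suc k)) (\<lambda>\<omega>. (X k \<omega>, Z (Suc k) \<omega>))"
      by (rule determined_by_compose2) (rule refl)
    show ?case
      by (rule determined_by_compose2[OF detI *, where h = "\<lambda>i (x, z). X_step A B i z x"])
        (simp_all add: past_def assms(9))
  qed
  let ?Xs = "moore_penrose A ** B"
  have A: "A \<noteq> 0" using assms(1)[of undefined] by (auto simp: row_def vec_eq_iff)
  have \<rho>: "0 \<le> \<rho>" "\<rho> < 1"
    using A sigma_min_pos[OF A] power_mono[OF sigma_min_le_norm[OF A], of 2]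
    by (simp_all add: assms(10))
  have invZ: "A ** moore_penrose A ** (Z k \<omega> - Zstar) = Z k \<omega> - Zstar" if "\<omega> \<in> space M" for k \<omega>
  proof (induction k)
    case 0
    have "B - Zstar = A ** moore_penrose A ** B" by (simp add: assms(11) matrix_mult_diff_right)
    then show ?case using that by (simp add: assms(6) matrix_mul_assoc mult_moore_penrose_mult)
  next
    case (Suc k)
    then show ?case using that unfolding assms(8)[OF that] assms(11) by (intro Z_step_invariant)
  qed
  have invX: "moore_penrose A ** A ** (X k \<omega> - ?Xs) = X k \<omega> - ?Xs" if "\<omega> \<in> space M" for k \<omega>
  proof (induction k)
    case 0
    show ?case
      using that moore_penrose_mult_eq_if_columns_in_span[OF assms(3)]
      by (simp add: assms(7) matrix_mult_diff_left matrix_mul_assoc moore_penrose_mult_idem)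
  next
    case (Suc k)
    then show ?case unfolding assms(9)[OF that] by (rule X_step_invariant)
  qed
  define eZ where "eZ k = expectation (\<lambda>\<omega>. (norm (Z k \<omega> - Zstar))\<^sup>2)" for k
  define eX where "eX k = expectation (\<lambda>\<omega>. (norm (X k \<omega> - ?Xs))\<^sup>2)" for k
  have intZ: "integrable M (\<lambda>\<omega>. (norm (Z k \<omega> - Zstar))\<^sup>2)" for k
    by (rule integrable_determined_by[OF rv _ determined_by_compose[OF detZ]]) simp
  have intX: "integrable M (\<lambda>\<omega>. (norm (X k \<omega> - ?Xs))\<^sup>2)" for k
    by (rule integrable_determined_by[OF rv fin determined_by_compose[OF detX]])
  have eZ_Suc: "eZ (Suc k) \<le> \<rho> * eZ k" for k
  proof -
    let ?f = "\<lambda>j \<omega>. (norm (Z_step A j (Z k \<omega>) - Zstar))\<^sup>2"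
    have f: "determined_by M Y (Inr ` {..<k}) (?f j)" for j
      by (rule determined_by_compose[OF detZ])
    have "eZ (Suc k) = expectation (\<lambda>\<omega>. ?f (J k \<omega>) \<omega>)"
      unfolding eZ_def by (rule Bochner_Integration.integral_cong) (simp_all add: assms(8))
    also have "\<dots> = expectation (\<lambda>\<omega>. \<Sum>j\<in>UNIV. prob {\<omega> \<in> space M. J k \<omega> = j} * ?f j \<omega>)"
      by (rule expectation_independent_index[OF indep _ _ f detJ[of k "{Inr k}"]]) auto
    also have "\<dots> \<le> expectation (\<lambda>\<omega>. \<rho> * (norm (Z k \<omega> - Zstar))\<^sup>2)"
    proof (rule integral_mono)
      show "integrable M (\<lambda>\<omega>. \<Sum>j\<in>UNIV. prob {\<omega> \<in> space M. J k \<omega> = j} * ?f j \<omega>)"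
        by (intro Bochner_Integration.integrable_sum integrable_mult_right
            integrable_determined_by[OF rv _ f]) simp
      show "integrable M (\<lambda>\<omega>. \<rho> * (norm (Z k \<omega> - Zstar))\<^sup>2)" using intZ by simp
      show "(\<Sum>j\<in>UNIV. prob {\<omega> \<in> space M. J k \<omega> = j} * ?f j \<omega>) \<le> \<rho> * (norm (Z k \<omega> - Zstar))\<^sup>2"
        if "\<omega> \<in> space M" for \<omega>
        using Z_step_mean_contraction[OF assms(2) invZ[OF that, of k, unfolded assms(11)]]
        by (simp add: probJ assms(10,11))
    qed
    finally show ?thesis by (simp add: eZ_def)
  qed
  have eX_Suc: "eX (Suc k) \<le> \<rho> * eX k + eZ (Suc k) / (norm A)\<^sup>2" for k
  proof -
    \<comment> \<open>The row step uses the already updated \<open>Z (Suc k)\<close>, so the history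
      includes the current column index but not the current row index \<open>Inl k\<close>.\<close>
    let ?K = "past k \<union> {Inr k}"
    let ?f = "\<lambda>i \<omega>. (norm (X_step A B i (Z (Suc k) \<omega>) (X k \<omega>) - ?Xs))\<^sup>2"
    have f: "determined_by M Y ?K (?f i)" for i
    proof (rule determined_by_compose2)
      show "determined_by M Y ?K (X k)" using detX by (rule determined_by_mono) auto
      show "determined_by M Y ?K (Z (Suc k))"
        using detZ by (rule determined_by_mono) (auto simp: past_def less_Suc_eq)
    qed (rule refl)
    have finK: "finite ?K" using fin by simp
    have "eX (Suc k) = expectation (\<lambda>\<omega>. ?f (I k \<omega>) \<omega>)"
      unfolding eX_def by (rule Bochner_Integration.integral_cong) (simp_all add: assms(9))
    also have "\<dots> = expectation (\<lambda>\<omega>. \<Sum>i\<in>UNIV. prob {\<omega> \<in> space M. I k \<omega> = i} * ?f i \<omega>)"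
      by (rule expectation_independent_index[OF indep finK _ f detI[of k "{Inl k}"]])
        (auto simp: past_def)
    also have "\<dots> \<le> expectation (\<lambda>\<omega>. \<rho> * (norm (X k \<omega> - ?Xs))\<^sup>2
        + (norm (Z (Suc k) \<omega> - Zstar))\<^sup>2 / (norm A)\<^sup>2)"
    proof (rule integral_mono)
      show "integrable M (\<lambda>\<omega>. \<Sum>i\<in>UNIV. prob {\<omega> \<in> space M. I k \<omega> = i} * ?f i \<omega>)"
        by (intro Bochner_Integration.integrable_sum integrable_mult_right
            integrable_determined_by[OF rv finK f])
      show "integrable M (\<lambda>\<omega>. \<rho> * (norm (X k \<omega> - ?Xs))\<^sup>2
        + (norm (Z (Suc k) \<omega> - Zstar))\<^sup>2 / (norm A)\<^sup>2)"
        using intX intZ by simp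
      show "(\<Sum>i\<in>UNIV. prob {\<omega> \<in> space M. I k \<omega> = i} * ?f i \<omega>)
        \<le> \<rho> * (norm (X k \<omega> - ?Xs))\<^sup>2 + (norm (Z (Suc k) \<omega> - Zstar))\<^sup>2 / (norm A)\<^sup>2"
        if "\<omega> \<in> space M" for \<omega>
        using X_step_mean_contraction[OF assms(1) invX[OF that, of k], of "Z (Suc k) \<omega>"]
        by (simp add: probI assms(10,11))
    qed
    also have "\<dots> = \<rho> * eX k + eZ (Suc k) / (norm A)\<^sup>2"
      using intX intZ by (simp add: eX_def eZ_def)
    finally show ?thesis .
  qed
  let ?a = "(norm (B - Zstar))\<^sup>2 / (norm A)\<^sup>2" and ?b = "(norm (X0 - ?Xs))\<^sup>2"
  have eZ_bound: "eZ k \<le> \<rho> ^ k * (norm (B - Zstar))\<^sup>2" for k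
  proof (induction k)
    case 0
    have "eZ 0 = expectation (\<lambda>\<omega>. (norm (B - Zstar))\<^sup>2)"
      unfolding eZ_def by (rule Bochner_Integration.integral_cong) (simp_all add: assms(6))
    then show ?case by (simp add: prob_space)
  next
    case (Suc k)
    then show ?case
      using eZ_Suc[of k] mult_left_mono[OF Suc \<rho>(1)] by (simp add: mult.assoc)
  qed
  have eX_bound: "eX k \<le> real k * \<rho> ^ k * ?a + \<rho> ^ k * ?b" for k
  proof (induction k)
    case 0
    have "eX 0 = expectation (\<lambda>\<omega>. ?b)"
      unfolding eX_def by (rule Bochner_Integration.integral_cong) (simp_all add: assms(7))
    then show ?case by (simp add: prob_space)
  next
    case (Suc k)
    \<comment> \<open>The perturbation comes from \<open>eZ (Suc k)\<close> and carries
      \<open>\<rho> ^ Suc k\<close>, the same power as the contracted old terms. Each step thus adds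
      one to the factor \<open>real k\<close>.\<close>
    have "eX (Suc k) \<le> \<rho> * (real k * \<rho> ^ k * ?a + \<rho> ^ k * ?b) + \<rho> ^ Suc k * ?a"
      using eX_Suc[of k] mult_left_mono[OF Suc \<rho>(1)]
        divide_right_mono[OF eZ_bound[of "Suc k"], of "(norm A)\<^sup>2"] by simp
    then show ?case by (simp add: algebra_simps add_divide_distrib)
  qed
  obtain c q where "0 \<le> c" "0 \<le> q" "q < 1"
    and "\<And>k. real k * \<rho> ^ k * ?a + \<rho> ^ k * ?b \<le> c * q ^ k"
    using linear_times_power_bounded[OF \<rho>, of ?a ?b] by auto
  then have "converges_linearly_in_mean_square M X ?Xs"
    unfolding converges_linearly_in_mean_square_def
    using intX eX_bound[unfolded eX_def] by (meson order_trans)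
  then show ?thesis using eX_bound by (simp add: eX_def)
qed

end
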